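(* Let $g\ge4$ be even and let $m=\frac{g^g-1}{g-1}=1+g+\dots+g^{g-1}$ (the number whose base-$g$ expansion consists of $g$ ones). Then $m$ is primitive. The integer $x_0=\sum_{j=1}^{g-1} j\,g^{g-1-j}$ (whose base-$g$ digits are $1,2,\dots,g-1$) is a point of an extreme cycle for $\{0,m\}$ of length $g$, and the extreme cycle containing $x_0$ is the only non-trivial extreme cycle for $\{0,m\}$.
   Context: For an odd integer $m\ge1$, an extreme cycle for the digit set $\{0,m\}$ (with respect to the even integer $g\ge4$) is a finite set of distinct integers $\{x_0,\dots,x_{r-1}\}$ together with digits $l_0,\dots,l_{r-1}\in\{0,m\}$ such that $x_{j+1}=(x_j+l_j)/g$ for $0\le j\le r-2$ and $x_0=(x_{r-1}+l_{r-1})/g$; its length is $r$. The cycle $\{0\}$ is the trivial extreme cycle. $m$ is complete if the only extreme cycle for $\{0,m\}$ is the trivial one, and incomplete otherwise. An odd number $m$ is primitive if it is incomplete and every proper divisor of $m$ is complete. *)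

theory Defs
  imports Complex_Main
begin

text \<open>
  A cycle is the set of its pairs (point, digit). This remembers which digit belongs to which
  point but not which point is listed first, so two listings that differ by a rotation are the
  same cycle. The order is not lost: the successor of a pair \<open>(x, l)\<close> has
  first component \<open>(x + l) / g\<close>. The division is real division, so each equation includes the
  requirement that the quotient is an integer.
\<close>

definition extreme_cycle_of_length ::
    "nat \<Rightarrow> nat \<Rightarrow> nat \<Rightarrow> (int \<times> int) set \<Rightarrow> bool" where
  "extreme_cycle_of_length g m r C \<longleftrightarrow>
     (\<exists>x l :: nat \<Rightarrow> int.
        1 \<le> r \<and>
        inj_on x {..<r} \<and>
        (\<forall>j<r. l j \<in> {0, int m}) \<and>
        (\<forall>j. j + 1 < r \<longrightarrow>
           real_of_int (x (j + 1)) = (real_of_int (x j) + real_of_int (l j)) / real g) \<and>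
        real_of_int (x 0) = (real_of_int (x (r - 1)) + real_of_int (l (r - 1))) / real g \<and>
        C = (\<lambda>j. (x j, l j)) ` {..<r})"

definition extreme_cycle :: "nat \<Rightarrow> nat \<Rightarrow> (int \<times> int) set \<Rightarrow> bool" where
  "extreme_cycle g m C \<longleftrightarrow> (\<exists>r. extreme_cycle_of_length g m r C)"

definition cycle_points :: "(int \<times> int) set \<Rightarrow> int set" where
  "cycle_points C = fst ` C"

text \<open>The cycle with the single point 0; the equation \<open>0 = (0 + l) / g\<close> forces the digit 0.\<close>

definition trivial_cycle :: "(int \<times> int) set" where
  "trivial_cycle = {(0, 0)}"

lemma extreme_cycle_trivial: "extreme_cycle_of_length g m 1 trivial_cycle"
  unfolding extreme_cycle_of_length_def trivial_cycle_def
  by (intro exI[of _ "\<lambda>_. 0"]) (auto simp: lessThan_Suc)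

lemma extreme_cycle_points_0:
  assumes "extreme_cycle g m C" "cycle_points C = {0}" "g \<ge> 1"
  shows "C = trivial_cycle"
proof -
  from assms(1) obtain r where "extreme_cycle_of_length g m r C"
    unfolding extreme_cycle_def by blast
  then obtain x l where "1 \<le> r \<and> inj_on x {..<r} \<and> (\<forall>j<r. l j \<in> {0, int m}) \<and>
      (\<forall>j. j + 1 < r \<longrightarrow>
         real_of_int (x (j + 1)) = (real_of_int (x j) + real_of_int (l j)) / real g) \<and>
      real_of_int (x 0) = (real_of_int (x (r - 1)) + real_of_int (l (r - 1))) / real g \<and>
      C = (\<lambda>j. (x j, l j)) ` {..<r}"
    unfolding extreme_cycle_of_length_def by (elim exE)
  then have r: "1 \<le> r" "inj_on x {..<r}"
    and e: "real_of_int (x 0) = (real_of_int (x (r - 1)) + real_of_int (l (r - 1))) / real g"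
    and C: "C = (\<lambda>j. (x j, l j)) ` {..<r}"
    by simp_all
  have im: "x ` {..<r} = {0}"
    using assms(2) C by (simp add: cycle_points_def image_image)
  have "r = 1"
    using card_image[OF r(2)] im by simp
  moreover from this have "x 0 = 0"
    using im by (simp add: lessThan_Suc)
  ultimately show ?thesis
    using e assms(3) C by (simp add: trivial_cycle_def lessThan_Suc)
qed

definition complete_for :: "nat \<Rightarrow> nat \<Rightarrow> bool" where
  "complete_for g m \<longleftrightarrow> (\<forall>C. extreme_cycle g m C \<longleftrightarrow> C = trivial_cycle)"

definition primitive_for :: "nat \<Rightarrow> nat \<Rightarrow> bool" where
  "primitive_for g m \<longleftrightarrow>
     odd m \<and> \<not> complete_for g m \<and> (\<forall>d. d dvd m \<and> d \<noteq> m \<longrightarrow> complete_for g d)"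

end

theory Submission
  imports Defs "HOL-Number_Theory.Cong"
begin

text \<open>
  Unrolling a cycle for \<open>{0, d}\<close> with \<open>d\<close> dividing \<open>m\<close> gives a periodic solution of
  \<open>g X\<^sub>n\<^sub>+\<^sub>1 = X\<^sub>n + L\<^sub>n\<close> with \<open>0 \<le> X\<^sub>n \<le> d / (g - 1) < d\<close>. Since \<open>g\<^sup>g \<equiv> 1\<close> modulo \<open>d\<close>,
  \<open>X\<close> has period \<open>g\<close>, and \<open>X\<^sub>n (g - 1) (m / d) = E\<close>, where \<open>E\<close> is the number whose \<open>g\<close> base-\<open>g\<close>
  digits are the \<open>L\<^sub>n\<^sub>+\<^sub>j / d \<in> {0, 1}\<close>. Casting out \<open>g - 1\<close>, the number of ones in \<open>E\<close> is \<open>0\<close>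
  or \<open>g - 1\<close>. In the second case \<open>E = m - g\<^sup>i\<close>, and \<open>m / d\<close>, being coprime to \<open>g\<close> and a divisor of
  both \<open>m\<close> and \<open>E\<close>, is \<open>1\<close>; the \<open>g\<close> points \<open>(m - g\<^sup>i) / (g - 1)\<close> form a single cycle, in which
  each step lowers \<open>i\<close> by one modulo \<open>g\<close>, and \<open>x\<^sub>0\<close> is the point with \<open>i = 1\<close>.
\<close>

section \<open>Cycles as periodic integer sequences\<close>

text \<open>Indexing by all naturals removes the special case at the end of a listing. Periodicity
  is demanded of \<open>X\<close>; the recurrence passes it on to \<open>L\<close>.\<close>

definition cycle_sequence ::
    "nat \<Rightarrow> nat \<Rightarrow> nat \<Rightarrow> (nat \<Rightarrow> int) \<Rightarrow> (nat \<Rightarrow> int) \<Rightarrow> bool" where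
  "cycle_sequence g d r X L \<longleftrightarrow>
     1 \<le> r \<and> (\<forall>n. int g * X (Suc n) = X n + L n) \<and> (\<forall>n. L n \<in> {0, int d}) \<and>
     (\<forall>n. X (n + r) = X n)"

text \<open>Indices are read modulo \<open>r\<close>, so the closing equation becomes the ordinary
  step at indices congruent to \<open>r - 1\<close>.\<close>

lemma extreme_cycle_sequence:
  assumes "extreme_cycle g d C" and g: "g \<ge> 1"
  obtains r X L where "cycle_sequence g d r X L" "C = range (\<lambda>n. (X n, L n))"
proof -
  obtain r where "extreme_cycle_of_length g d r C"
    using assms(1) unfolding extreme_cycle_def by blast
  then obtain x l where "1 \<le> r \<and> inj_on x {..<r} \<and> (\<forall>j<r. l j \<in> {0, int d}) \<and>
      (\<forall>j. j + 1 < r \<longrightarrow>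
         real_of_int (x (j + 1)) = (real_of_int (x j) + real_of_int (l j)) / real g) \<and>
      real_of_int (x 0) = (real_of_int (x (r - 1)) + real_of_int (l (r - 1))) / real g \<and>
      C = (\<lambda>j. (x j, l j)) ` {..<r}"
    unfolding extreme_cycle_of_length_def by (elim exE)
  then have r: "1 \<le> r" and l: "\<forall>j<r. l j \<in> {0, int d}"
    and step: "\<forall>j. j + 1 < r \<longrightarrow>
      real_of_int (x (j + 1)) = (real_of_int (x j) + real_of_int (l j)) / real g"
    and last: "real_of_int (x 0) = (real_of_int (x (r - 1)) + real_of_int (l (r - 1))) / real g"
    and C: "C = (\<lambda>j. (x j, l j)) ` {..<r}"
    by simp_all
  have *: "int g * x (Suc n mod r) = x (n mod r) + l (n mod r)" for n
  proof -
    have "real_of_int (x (Suc n mod r)) = (real_of_int (x (n mod r)) + real_of_int (l (n mod r))) / real g"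
    proof (cases "Suc (n mod r) = r")
      case True
      then have "Suc n mod r = 0" "n mod r = r - 1" by (auto simp: mod_Suc)
      then show ?thesis using last by simp
    next
      case False
      then have "Suc n mod r = n mod r + 1" by (simp add: mod_Suc)
      moreover have "n mod r + 1 < r" using False r mod_less_divisor[of r n] by linarith
      ultimately show ?thesis using step by simp
    qed
    then have "real g * real_of_int (x (Suc n mod r)) = real_of_int (x (n mod r)) + real_of_int (l (n mod r))"
      using g by (simp add: field_simps)
    then have "real_of_int (int g * x (Suc n mod r)) = real_of_int (x (n mod r) + l (n mod r))"
      by simp
    then show ?thesis by linarith
  qed
  have "cycle_sequence g d r (\<lambda>n. x (n mod r)) (\<lambda>n. l (n mod r))"
    unfolding cycle_sequence_def using r l * by auto
  moreover have "C = range (\<lambda>n. (x (n mod r), l (n mod r)))"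
  proof -
    have "range (\<lambda>n. n mod r) = {..<r}"
    proof
      show "{..<r} \<subseteq> range (\<lambda>n. n mod r)" by (metis lessThan_iff mod_less rangeI subsetI)
    qed (use r in auto)
    then have "C = (\<lambda>j. (x j, l j)) ` range (\<lambda>n. n mod r)" using C by simp
    then show ?thesis by (simp only: image_image)
  qed
  ultimately show ?thesis using that by blast
qed

text \<open>The iterated recurrence collects the digits into a base-\<open>g\<close> expansion. When
  \<open>n\<close> is a period, this is a closed formula for \<open>X k\<close>.\<close>

lemma cycle_sequence_unfold:
  assumes "cycle_sequence g d r X L"
  shows "int g ^ n * X (k + n) = X k + (\<Sum>j<n. int g ^ j * L (k + j))"
proof (induction n)
  case (Suc n)
  have "int g ^ Suc n * X (k + Suc n) = int g ^ n * (X (k + n) + L (k + n))"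
    using assms by (simp add: cycle_sequence_def)
  then show ?case using Suc by (simp add: algebra_simps)
qed simp

text \<open>Over the period \<open>r\<close>, unfolding writes \<open>(g^r - 1) * X n\<close> as a
  base-\<open>g\<close> sum with digits between 0 and \<open>d\<close>; comparison with the
  geometric sum gives the upper bound.\<close>

lemma cycle_sequence_bounds:
  assumes c: "cycle_sequence g d r X L" and g: "g \<ge> 2"
  shows "0 \<le> X n" "(int g - 1) * X n \<le> int d"
proof -
  have r: "r \<ge> 1" and L: "L j \<in> {0, int d}" for j
    using c by (auto simp: cycle_sequence_def)
  have pos: "int g ^ r - 1 > 0" using r g by (simp add: one_less_power)
  have e: "(int g ^ r - 1) * X n = (\<Sum>j<r. int g ^ j * L (n + j))"
    using cycle_sequence_unfold[OF c, of r n] c by (simp add: cycle_sequence_def algebra_simps)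
  have L0: "0 \<le> L j" "L j \<le> int d" for j using L[of j] by auto
  have "0 \<le> (int g ^ r - 1) * X n" unfolding e using L0 by (intro sum_nonneg) simp
  then show "0 \<le> X n" using pos by (simp add: zero_le_mult_iff)
  have "(\<Sum>j<r. int g ^ j * L (n + j)) \<le> (\<Sum>j<r. int g ^ j * int d)"
    using L0 by (intro sum_mono mult_left_mono) auto
  then have "(int g - 1) * ((int g ^ r - 1) * X n) \<le> (int g - 1) * (\<Sum>j<r. int g ^ j * int d)"
    unfolding e using g by (intro mult_left_mono) auto
  also have "\<dots> = (int g ^ r - 1) * int d"
    unfolding sum_distrib_right[symmetric] power_diff_1_eq by simp
  finally have "(int g ^ r - 1) * ((int g - 1) * X n) \<le> (int g ^ r - 1) * int d"
    by (simp add: algebra_simps)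
  then show "(int g - 1) * X n \<le> int d" using pos by simp
qed

text \<open>Modulo \<open>d\<close> all digits vanish and \<open>g^p\<close> is 1, so the two terms
  are congruent. Since \<open>g - 1\<close> is at least 2, the bounds place both between 0 and
  \<open>d - 1\<close>.\<close>

lemma cycle_sequence_period:
  assumes c: "cycle_sequence g d r X L" and g: "g \<ge> 3" and d: "d \<ge> 1"
    and dvd: "int d dvd int g ^ p - 1"
  shows "X (n + p) = X n"
proof -
  have L: "int d dvd L j" for j
    using c by (auto simp: cycle_sequence_def dest: spec[of _ j])
  have "int d dvd (\<Sum>j<p. int g ^ j * L (n + j))"
    using L by (intro dvd_sum) auto
  then have "int d dvd (\<Sum>j<p. int g ^ j * L (n + j)) - (int g ^ p - 1) * X (n + p)"
    using dvd by (intro dvd_diff) auto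
  then have dv: "int d dvd X (n + p) - X n"
    using cycle_sequence_unfold[OF c, of p n] by (simp add: algebra_simps)
  have small: "0 \<le> X k \<and> X k < int d" for k
  proof -
    have b: "0 \<le> X k" "(int g - 1) * X k \<le> int d"
      using cycle_sequence_bounds[OF c, of k] g by auto
    then have "2 * X k \<le> (int g - 1) * X k" using g by (intro mult_right_mono) auto
    then show ?thesis using b d by linarith
  qed
  then have "\<bar>X (n + p) - X n\<bar> < int d" using small[of n] small[of "n + p"] by linarith
  then show ?thesis using dv dvd_imp_le_int[of "X (n + p) - X n" "int d"] by force
qed

section \<open>Terms of a cycle for a divisor of the repunit\<close>

lemma sum_powers_cong_card:
  "[(\<Sum>j\<in>S. int g ^ j) = int (card S)] (mod (int g - 1))"
proof -
  have "[int g = 1] (mod (int g - 1))" by (simp add: cong_iff_dvd_diff)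
  then have "[int g ^ j = 1] (mod (int g - 1))" for j
    using cong_pow[of "int g" 1 _ j] by simp
  then have "[(\<Sum>j\<in>S. int g ^ j) = (\<Sum>j\<in>S. 1)] (mod (int g - 1))" by (intro cong_sum)
  then show ?thesis by simp
qed

text \<open>The cofactor \<open>k\<close> covers the repunit (\<open>k = 1\<close>) and its proper
  divisors at once. The index \<open>i\<close> is the position of the only zero among the next
  \<open>g\<close> digits, so \<open>i = 0\<close> means that the current digit is 0.\<close>

lemma cycle_sequence_repunit:
  assumes c: "cycle_sequence g d r X L" and g: "g \<ge> 3"
    and dk: "(\<Sum>i<g. g ^ i) = d * k"
  shows "X n = 0 \<and> L n = 0 \<or>
    k = 1 \<and> (\<exists>i<g. (int g - 1) * X n = int d - int g ^ i \<and> L n = (if i = 0 then 0 else int d))"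
proof -
  define S where "S = {j. j < g \<and> L (n + j) \<noteq> 0}"
  have [simp]: "finite S" unfolding S_def by simp
  have L: "L (n + j) = (if j \<in> S then int d else 0)" if "j < g" for j
    using c that by (auto simp: S_def cycle_sequence_def)
  have dk': "(\<Sum>i<g. int g ^ i) = int d * int k"
    using arg_cong[OF dk, of int] by simp
  have geo: "int g ^ g - 1 = (int g - 1) * (int d * int k)"
    unfolding dk'[symmetric] by (rule power_diff_1_eq)
  have "(\<Sum>i<g. g ^ i) > 0" using g by (intro sum_pos) (auto simp: lessThan_empty_iff)
  then have d: "d \<ge> 1" using dk by (cases d) auto
  have per: "X (n + g) = X n"
    using cycle_sequence_period[OF c g d, of g] geo by simp
  have E: "(int g - 1) * int k * X n = (\<Sum>j\<in>S. int g ^ j)"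
  proof -
    have "(int g ^ g - 1) * X n = (\<Sum>j<g. int g ^ j * L (n + j))"
      using cycle_sequence_unfold[OF c, of g n] per by (simp add: algebra_simps)
    also have "\<dots> = (\<Sum>j<g. if j \<in> S then int g ^ j * int d else 0)"
      by (intro sum.cong) (auto simp: L)
    also have "\<dots> = (\<Sum>j\<in>S. int g ^ j * int d)"
      by (subst sum.inter_filter[symmetric]) (auto simp: S_def intro!: sum.cong)
    also have "\<dots> = int d * (\<Sum>j\<in>S. int g ^ j)" by (simp add: sum_distrib_left mult.commute)
    finally have "int d * ((int g - 1) * int k * X n) = int d * (\<Sum>j\<in>S. int g ^ j)"
      unfolding geo by (simp add: algebra_simps)
    then show ?thesis using d by simp
  qed
  have Ssub: "S \<subseteq> {..<g}" by (auto simp: S_def)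
  have "(int g - 1) dvd (\<Sum>j\<in>S. int g ^ j)" unfolding E[symmetric] by simp
  then have dvdc: "(int g - 1) dvd int (card S)"
    using sum_powers_cong_card cong_dvd_iff by blast
  have cle: "card S \<le> g" using card_mono[OF _ Ssub] by simp
  \<comment> \<open>This rules out \<open>g\<close> ones: \<open>g - 1\<close> would divide
    \<open>g\<close>, hence equal 1, against \<open>g >= 3\<close>.\<close>
  have "\<not> (int g - 1) dvd int g"
  proof
    assume "(int g - 1) dvd int g"
    then have "(int g - 1) dvd int g - (int g - 1)" by (rule dvd_diff) (rule dvd_refl)
    then have "\<bar>int g - 1\<bar> = 1" by simp
    then show False using g by linarith
  qed
  then have "card S \<noteq> g" using dvdc by auto
  moreover have "card S = 0 \<or> int g - 1 \<le> int (card S)"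
    using dvdc zdvd_imp_le[of "int g - 1" "int (card S)"] by linarith
  ultimately consider "card S = 0" | "card S = g - 1" using cle by linarith
  then show ?thesis
  proof cases
    case 1
    then have "S = {}" by simp
    moreover have "k \<noteq> 0" using dk \<open>(\<Sum>i<g. g ^ i) > 0\<close> by (metis mult_0_right less_irrefl)
    ultimately have "X n = 0" using E g by simp
    moreover have "L n = 0" using L[of 0] g \<open>S = {}\<close> by simp
    ultimately show ?thesis by simp
  next
    case 2
    then have "card ({..<g} - S) = 1" using Ssub g by (simp add: card_Diff_subset)
    then obtain i where i: "{..<g} - S = {i}" by (auto simp: card_Suc_eq One_nat_def)
    then have S: "S = {..<g} - {i}" "i < g" using Ssub by auto
    then have E': "(\<Sum>j\<in>S. int g ^ j) = int d * int k - int g ^ i"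
      by (simp add: sum_diff1 dk')
    \<comment> \<open>Both the repunit \<open>d * k\<close> and the expansion
      \<open>d * k - g^i\<close> are multiples of \<open>k\<close>, hence so is
      \<open>g^i\<close>.\<close>
    have "int k dvd int d * int k - ((int g - 1) * int k * X n)" by simp
    then have kg: "int k dvd int g ^ i" unfolding E E' by simp
    \<comment> \<open>The repunit is 1 modulo \<open>g\<close>, so its divisor \<open>k\<close> is
      coprime to \<open>g\<close>.\<close>
    obtain g' where g': "g = Suc g'" using g by (cases g) auto
    have "int d * int k = 1 + int g * (\<Sum>j<g'. int g ^ j)"
    proof -
      have "(\<Sum>i<Suc g'. int g ^ i) = 1 + (\<Sum>i<g'. int g ^ Suc i)"
        by (subst sum.lessThan_Suc_shift) simp
      then show ?thesis using dk' g' by (simp add: sum_distrib_left)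
    qed
    then have one: "int d * int k - int g * (\<Sum>j<g'. int g ^ j) = 1" by linarith
    have "coprime (int k) (int g)"
    proof (rule coprimeI)
      fix c assume "c dvd int k" "c dvd int g"
      then have "c dvd int d * int k - int g * (\<Sum>j<g'. int g ^ j)" by (intro dvd_diff) auto
      then show "is_unit c" unfolding one .
    qed
    then have "coprime (int k) (int g ^ i)" by simp
    then have "is_unit (int k)" using kg coprime_common_divisor dvd_refl by blast
    then have k: "k = 1" by simp
    have "(int g - 1) * X n = int d - int g ^ i"
      using E E' k by simp
    moreover have "L n = (if i = 0 then 0 else int d)"
      using L[of 0] g S by auto
    ultimately show ?thesis using k S by blast
  qed
qed

section \<open>The points of the non-trivial cycle\<close>

lemma pred_dvd_repunit_diff_power:
  "(int g - 1) dvd (\<Sum>j<g. int g ^ j) - int g ^ i"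
proof -
  have "[(\<Sum>j<g. int g ^ j) - (\<Sum>j\<in>{i}. int g ^ j) = int g - 1] (mod (int g - 1))"
    using cong_diff[OF sum_powers_cong_card[of g "{..<g}"] sum_powers_cong_card[of g "{i}"]]
    by simp
  then show ?thesis by (simp add: cong_dvd_iff)
qed

text \<open>For \<open>i < g\<close>, the index counts the cycle steps from this point to the one
  with digit 0. The division is exact by \<open>pred_dvd_repunit_diff_power\<close>.\<close>

definition repunit_point :: "nat \<Rightarrow> nat \<Rightarrow> int" where
  "repunit_point g i = ((\<Sum>j<g. int g ^ j) - int g ^ i) div (int g - 1)"

definition repunit_pair :: "nat \<Rightarrow> nat \<Rightarrow> int \<times> int" where
  "repunit_pair g i = (repunit_point g i, if i = 0 then 0 else \<Sum>j<g. int g ^ j)"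

lemma repunit_point_mult:
  "(int g - 1) * repunit_point g i = (\<Sum>j<g. int g ^ j) - int g ^ i"
  unfolding repunit_point_def using pred_dvd_repunit_diff_power by (rule dvd_mult_div_cancel)

lemma repunit_point_eqI:
  assumes "g \<ge> 2" "(int g - 1) * y = (\<Sum>j<g. int g ^ j) - int g ^ i"
  shows "y = repunit_point g i"
proof -
  have "(int g - 1) * y = (int g - 1) * repunit_point g i"
    unfolding repunit_point_mult by (rule assms(2))
  then show ?thesis using assms(1) by simp
qed

lemma inj_repunit_point:
  assumes "g \<ge> 2"
  shows "inj (repunit_point g)"
proof
  fix i j assume "repunit_point g i = repunit_point g j"
  then have "int g ^ i = int g ^ j"
    using repunit_point_mult[of g i] repunit_point_mult[of g j] by simp
  then show "i = j" using assms by (simp add: power_inject_exp)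
qed

text \<open>Positivity separates these points from 0, and so their cycle from the trivial
  one.\<close>

lemma repunit_point_pos:
  assumes "g \<ge> 2" "i < g"
  shows "repunit_point g i > 0"
proof -
  have "int g ^ i < (\<Sum>j<g. int g ^ j)"
  proof -
    have "(\<Sum>j<g. int g ^ j) = int g ^ i + (\<Sum>j\<in>{..<g} - {i}. int g ^ j)"
      using assms by (intro sum.remove) auto
    moreover have "(\<Sum>j\<in>{..<g} - {i}. int g ^ j) > 0"
    proof (rule sum_pos)
      have "(if i = 0 then 1 else 0) \<in> {..<g} - {i}" using assms by auto
      then show "{..<g} - {i} \<noteq> {}" by blast
    qed (use assms in auto)
    ultimately show ?thesis by linarith
  qed
  then have "0 < (int g - 1) * repunit_point g i" unfolding repunit_point_mult by simp
  then show ?thesis using assms by (simp add: zero_less_mult_iff)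
qed

text \<open>With \<open>m\<close> the repunit, multiplying by \<open>g - 1\<close> gives
  \<open>g * (m - g^i) = (m - g^(i+1)) + (g - 1) * m\<close>. So a cycle step with digit
  \<open>m\<close> lowers the index by one.\<close>

lemma repunit_point_step:
  assumes "g \<ge> 2"
  shows "int g * repunit_point g i = repunit_point g (Suc i) + (\<Sum>j<g. int g ^ j)"
proof -
  have "(int g - 1) * (int g * repunit_point g i) = int g * ((int g - 1) * repunit_point g i)"
    by (rule mult.left_commute)
  also have "\<dots> = (int g - 1) * (repunit_point g (Suc i) + (\<Sum>j<g. int g ^ j))"
    unfolding distrib_left repunit_point_mult by (simp add: algebra_simps)
  finally have "(int g - 1) * (int g * repunit_point g i)
      = (int g - 1) * (repunit_point g (Suc i) + (\<Sum>j<g. int g ^ j))" .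
  then show ?thesis using assms by simp
qed

text \<open>With \<open>m\<close> the repunit, \<open>g^g = 1 + (g - 1) * m\<close> turns
  \<open>g * m - g^g\<close> into \<open>m - 1\<close>: the step with digit 0 leads from index 0 to
  \<open>g - 1\<close>.\<close>

lemma repunit_point_wrap:
  assumes "g \<ge> 2"
  shows "int g * repunit_point g (g - 1) = repunit_point g 0"
proof -
  have "int g * int g ^ (g - 1) = int g ^ g"
    using assms by (simp add: power_eq_if)
  moreover have "int g ^ g - 1 = (int g - 1) * (\<Sum>j<g. int g ^ j)" by (rule power_diff_1_eq)
  moreover have "(int g - 1) * (int g * repunit_point g (g - 1))
      = int g * (\<Sum>j<g. int g ^ j) - int g * int g ^ (g - 1)"
    using repunit_point_mult[of g "g - 1"] by (metis mult.left_commute right_diff_distrib)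
  ultimately have "(int g - 1) * (int g * repunit_point g (g - 1))
      = (int g - 1) * repunit_point g 0"
    unfolding repunit_point_mult by (simp add: algebra_simps)
  then show ?thesis using assms by simp
qed

lemma extreme_cycle_repunit:
  assumes g: "g \<ge> 2" and m: "m = (\<Sum>i<g. g ^ i)"
  shows "extreme_cycle_of_length g m g (repunit_pair g ` {..<g})"
proof -
  have m': "int m = (\<Sum>j<g. int g ^ j)" unfolding m by simp
  have quotI: "real_of_int a = (real_of_int b + real_of_int c) / real g"
    if "int g * a = b + c" for a b c
  proof -
    have "real_of_int (int g * a) = real_of_int (b + c)" using that by simp
    then have "real g * real_of_int a = real_of_int b + real_of_int c" by simp
    then show ?thesis using g by (simp add: field_simps)
  qed
  \<comment> \<open>Steps lower the index, so the listing starts at index \<open>g - 1\<close> and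
    the digit 0 falls on its last entry.\<close>
  let ?x = "\<lambda>j. repunit_point g (g - 1 - j)"
  let ?l = "\<lambda>j. if j = g - 1 then 0 else int m"
  have "inj_on ?x {..<g}"
    using inj_repunit_point[OF g] by (intro inj_onI) (auto dest: injD)
  moreover have "real_of_int (?x (j + 1)) = (real_of_int (?x j) + real_of_int (?l j)) / real g"
    if "j + 1 < g" for j
  proof (rule quotI)
    have "g - 1 - j = Suc (g - 1 - (j + 1))" using that by simp
    then show "int g * ?x (j + 1) = ?x j + ?l j"
      using repunit_point_step[OF g, of "g - 1 - (j + 1)"] m' that by simp
  qed
  moreover have "real_of_int (?x 0) = (real_of_int (?x (g - 1)) + real_of_int (?l (g - 1))) / real g"
    using repunit_point_wrap[OF g] by (intro quotI) simp
  moreover have "repunit_pair g ` {..<g} = (\<lambda>j. (?x j, ?l j)) ` {..<g}"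
  proof -
    have "(\<lambda>j. g - 1 - j) ` {..<g} = {..<g}"
    proof
      show "{..<g} \<subseteq> (\<lambda>j. g - 1 - j) ` {..<g}"
      proof
        fix i assume "i \<in> {..<g}"
        then have "i = g - 1 - (g - 1 - i)" "g - 1 - i \<in> {..<g}" by auto
        then show "i \<in> (\<lambda>j. g - 1 - j) ` {..<g}" by blast
      qed
    qed (use g in auto)
    then have "repunit_pair g ` {..<g} = (\<lambda>j. repunit_pair g (g - 1 - j)) ` {..<g}"
      by (metis image_image)
    also have "\<dots> = (\<lambda>j. (?x j, ?l j)) ` {..<g}"
      by (intro image_cong) (auto simp: repunit_pair_def m')
    finally show ?thesis .
  qed
  ultimately show ?thesis
    unfolding extreme_cycle_of_length_def using g
    by (intro exI[of _ ?x] exI[of _ ?l]) auto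
qed

section \<open>Uniqueness of the non-trivial cycle\<close>

text \<open>A zero has digit 0 and so propagates forward; periodicity carries it to earlier
  indices.\<close>

lemma cycle_sequence_zero:
  assumes c: "cycle_sequence g d r X L" and g: "g \<ge> 1"
    and dich: "\<And>n. X n = 0 \<Longrightarrow> L n = 0" and n: "X n = 0"
  shows "X k = 0"
proof -
  have r: "1 \<le> r" and step: "int g * X (Suc i) = X i + L i" and per: "X (i + r) = X i" for i
    using c by (auto simp: cycle_sequence_def)
  have fwd: "X (n + i) = 0" for i
  proof (induction i)
    case (Suc i)
    then show ?case using step[of "n + i"] dich[OF Suc] g by simp
  qed (simp add: n)
  have mult: "X (k + i * r) = X k" for i
  proof (induction i)
    case (Suc i)
    then show ?case using per[of "k + i * r"] by (simp add: algebra_simps)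
  qed simp
  have "k + n * r \<ge> n" using r by (simp add: trans_le_add2)
  then show ?thesis using fwd[of "k + n * r - n"] mult[of n] by simp
qed

text \<open>One zero term would make the cycle trivial, so every term is a
  \<open>repunit_pair\<close>, which forces \<open>k = 1\<close>. Following the steps shows that all
  \<open>g\<close> pairs occur.\<close>

lemma extreme_cycle_repunit_unique:
  assumes g: "g \<ge> 3" and dk: "(\<Sum>i<g. g ^ i) = d * k"
    and C: "extreme_cycle g d C" "C \<noteq> trivial_cycle"
  shows "k = 1 \<and> C = repunit_pair g ` {..<g}"
proof -
  have g2: "g \<ge> 2" and g1: "g \<ge> 1" using g by auto
  obtain r X L where c: "cycle_sequence g d r X L" and Ceq: "C = range (\<lambda>n. (X n, L n))"
    using extreme_cycle_sequence[OF C(1) g1] by blast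
  have step: "int g * X (Suc i) = X i + L i" for i
    using c by (auto simp: cycle_sequence_def)
  have dk': "(\<Sum>i<g. int g ^ i) = int d * int k"
    using arg_cong[OF dk, of int] by simp
  have dich: "X n = 0 \<and> L n = 0 \<or> k = 1 \<and> (\<exists>i<g. (X n, L n) = repunit_pair g i)" for n
    using cycle_sequence_repunit[OF c g dk, of n] repunit_point_eqI[OF g2, of "X n"] dk'
    by (fastforce simp: repunit_pair_def)
  have L0: "L n = 0" if "X n = 0" for n
    using dich[of n] repunit_point_pos[OF g2] that by (force simp: repunit_pair_def)
  have nz: "X n \<noteq> 0" for n
  proof
    assume "X n = 0"
    then have "X k = 0 \<and> L k = 0" for k
      using cycle_sequence_zero[OF c g1 L0] L0 by blast
    then show False using C(2) unfolding Ceq trivial_cycle_def by auto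
  qed
  then have k: "k = 1" and pair: "\<exists>i<g. (X n, L n) = repunit_pair g i" for n
    using dich by blast+
  have sub: "C \<subseteq> repunit_pair g ` {..<g}" using pair unfolding Ceq by fastforce
  have visit: "(X n, L n) = repunit_pair g i" if "X n = repunit_point g i" for n i
  proof -
    obtain i' where i': "(X n, L n) = repunit_pair g i'" using pair by blast
    then have "repunit_point g i' = repunit_point g i" using that by (simp add: repunit_pair_def)
    then have "i' = i" by (rule injD[OF inj_repunit_point[OF g2]])
    then show ?thesis using i' by simp
  qed
  \<comment> \<open>Every index left behind on the way down to \<open>i\<close> is positive, so its
    digit is nonzero and the step lowers the index.\<close>
  have down: "\<exists>n. X n = repunit_point g i" if "X n = repunit_point g (i + t)" "i + t < g" for n i t
    using that
  proof (induction t arbitrary: n)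
    case (Suc t)
    then have "L n = (\<Sum>j<g. int g ^ j)" using visit[of n "i + Suc t"] by (simp add: repunit_pair_def)
    then have "int g * X (Suc n) = int g * repunit_point g (i + t)"
      using step[of n] repunit_point_step[OF g2, of "i + t"] Suc.prems by simp
    then have "X (Suc n) = repunit_point g (i + t)" using g by simp
    then show ?case using Suc by simp
  qed auto
  \<comment> \<open>Descend from the start to index 0, wrap to \<open>g - 1\<close> and descend
    again: the second descent meets every index.\<close>
  obtain i where i: "i < g" "X 0 = repunit_point g i"
    using pair[of 0] by (auto simp: repunit_pair_def)
  obtain n0 where n0: "X n0 = repunit_point g 0" using down[of 0 0 i] i by auto
  then have "L n0 = 0" using visit[of n0 0] g by (simp add: repunit_pair_def)
  then have "int g * X (Suc n0) = int g * repunit_point g (g - 1)"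
    using step[of n0] n0 repunit_point_wrap[OF g2] by simp
  then have top: "X (Suc n0) = repunit_point g (g - 1)" using g by simp
  have "repunit_pair g j \<in> C" if "j < g" for j
  proof -
    have "j + (g - 1 - j) = g - 1" using that by simp
    then obtain n where "X n = repunit_point g j"
      using down[of "Suc n0" j "g - 1 - j"] top g by auto
    then have "repunit_pair g j = (X n, L n)" using visit[of n j] by simp
    then show ?thesis unfolding Ceq by blast
  qed
  then show ?thesis using sub k by auto
qed

section \<open>Digit expansion of \<open>x0\<close>, primitivity and conclusion\<close>

text \<open>Horner's rule: raising \<open>n\<close> by one multiplies the sum by \<open>g\<close>
  and appends the digit \<open>n + 1\<close>. For \<open>n = g - 1\<close> the right side is the
  repunit minus \<open>g\<close>, which belongs to the point of index 1.\<close>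

lemma sum_mult_power_rev:
  "(int g - 1) * (\<Sum>j=1..n. int j * int g ^ (n - j)) = (\<Sum>j\<le>n. int g ^ j) - int n - 1"
proof (induction n)
  case (Suc n)
  have "(\<Sum>j=1..Suc n. int j * int g ^ (Suc n - j))
      = int g * (\<Sum>j=1..n. int j * int g ^ (n - j)) + int (Suc n)"
    by (simp add: Suc_diff_le sum_distrib_left mult.left_commute)
  then have "(int g - 1) * (\<Sum>j=1..Suc n. int j * int g ^ (Suc n - j))
      = int g * ((\<Sum>j\<le>n. int g ^ j) - int n - 1) + (int g - 1) * int (Suc n)"
    unfolding Suc.IH[symmetric] by (simp add: algebra_simps)
  moreover have "(\<Sum>j\<le>Suc n. int g ^ j) = 1 + int g * (\<Sum>j\<le>n. int g ^ j)"
    by (subst sum.atMost_Suc_shift) (simp add: sum_distrib_left)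
  ultimately show ?case by (simp add: algebra_simps)
qed simp

lemma extreme_cycle_repunit_iff:
  assumes g: "g \<ge> 3" and m: "m = (\<Sum>i<g. g ^ i)"
  shows "extreme_cycle g m D \<and> D \<noteq> trivial_cycle \<longleftrightarrow> D = repunit_pair g ` {..<g}"
proof
  assume "extreme_cycle g m D \<and> D \<noteq> trivial_cycle"
  then show "D = repunit_pair g ` {..<g}"
    using extreme_cycle_repunit_unique[OF g, of m 1 D] m by simp
next
  assume D: "D = repunit_pair g ` {..<g}"
  have "extreme_cycle g m D"
    unfolding extreme_cycle_def D using extreme_cycle_repunit[OF _ m] g by fastforce
  moreover have "D \<noteq> trivial_cycle"
  proof
    assume "D = trivial_cycle"
    moreover have "repunit_pair g 0 \<in> D" unfolding D using g by simp
    ultimately have "repunit_point g 0 = 0" by (simp add: trivial_cycle_def repunit_pair_def)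
    then show False using repunit_point_pos[of g 0] g by simp
  qed
  ultimately show "extreme_cycle g m D \<and> D \<noteq> trivial_cycle" ..
qed

lemma odd_repunit:
  fixes g :: nat
  assumes "even g" "n \<ge> 1"
  shows "odd (\<Sum>i<n. g ^ i)"
proof -
  obtain n' where n': "n = Suc n'" using assms(2) by (cases n) auto
  have "(\<Sum>i<Suc n'. g ^ i) = 1 + (\<Sum>i<n'. g ^ Suc i)"
    by (subst sum.lessThan_Suc_shift) simp
  moreover have "even (\<Sum>i<n'. g ^ Suc i)" using assms(1) by (intro dvd_sum) simp
  ultimately show ?thesis using n' by simp
qed

text \<open>A proper divisor has cofactor \<open>k\<close> different from 1, whereas a non-trivial
  cycle would force \<open>k = 1\<close>.\<close>

lemma primitive_repunit:
  assumes g: "g \<ge> 3" and "even g" and m: "m = (\<Sum>i<g. g ^ i)"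
  shows "primitive_for g m"
  unfolding primitive_for_def
proof (intro conjI allI impI)
  show "odd m" unfolding m using assms by (intro odd_repunit) auto
  show "\<not> complete_for g m"
  proof
    assume "complete_for g m"
    then show False
      using extreme_cycle_repunit_iff[OF g m, of "repunit_pair g ` {..<g}"]
      by (simp add: complete_for_def)
  qed
next
  fix d assume "d dvd m \<and> d \<noteq> m"
  then obtain k where k: "m = d * k" "k \<noteq> 1" by auto
  have "C = trivial_cycle" if "extreme_cycle g d C" for C
    using extreme_cycle_repunit_unique[OF g k(1)[unfolded m] that] k(2) by auto
  moreover have "extreme_cycle g d trivial_cycle"
    unfolding extreme_cycle_def using extreme_cycle_trivial by (rule exI)
  ultimately show "complete_for g d" unfolding complete_for_def by auto
qed

lemma repunit_point_1:
  assumes g: "g \<ge> 2"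
  shows "repunit_point g 1 = (\<Sum>j=1..g-1. int j * int g ^ (g - 1 - j))"
proof (rule repunit_point_eqI[OF g, symmetric])
  have "{..g - 1} = {..<g}" using g by auto
  then show "(int g - 1) * (\<Sum>j=1..g-1. int j * int g ^ (g - 1 - j))
      = (\<Sum>j<g. int g ^ j) - int g ^ 1"
    using sum_mult_power_rev[of g "g - 1"] g by simp
qed

theorem theorem2p34:
  fixes g m :: nat and x0 :: int
  assumes "g \<ge> 4" and "even g"
    and "m = (\<Sum>i<g. g ^ i)"
    and "x0 = (\<Sum>j=1..g-1. int j * int g ^ (g - 1 - j))"
  shows "real m = (real g ^ g - 1) / (real g - 1)
    \<and> primitive_for g m
    \<and> (\<exists>C. extreme_cycle_of_length g m g C \<and> x0 \<in> cycle_points C \<and>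
           (\<forall>D. extreme_cycle g m D \<and> D \<noteq> trivial_cycle \<longleftrightarrow> D = C))"
proof (intro conjI exI allI)
  have g2: "g \<ge> 2" and g3: "g \<ge> 3" using assms(1) by auto
  show "real m = (real g ^ g - 1) / (real g - 1)"
    unfolding assms(3) using g2 geometric_sum[of "real g" g] by simp
  show "primitive_for g m" by (rule primitive_repunit[OF g3 assms(2,3)])
  show "extreme_cycle_of_length g m g (repunit_pair g ` {..<g})"
    by (rule extreme_cycle_repunit[OF g2 assms(3)])
  have "x0 = fst (repunit_pair g 1)"
    unfolding assms(4) repunit_point_1[OF g2, symmetric] by (simp add: repunit_pair_def)
  then show "x0 \<in> cycle_points (repunit_pair g ` {..<g})"
    using g2 by (simp add: cycle_points_def)
  show "extreme_cycle g m D \<and> D \<noteq> trivial_cycle \<longleftrightarrow> D = repunit_pair g ` {..<g}" for D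
    by (rule extreme_cycle_repunit_iff[OF g3 assms(3)])
qed

end
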